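(* Let $N\ge 1$, let $\Sigma\in\mathbb{R}^{N\times N}$ be symmetric positive definite, $\mu\in\mathbb{R}^N$, $\gamma>0$, $\beta>0$, and let $\omega_{t^+}\in\mathbb{R}^N$ satisfy $\iota'\omega_{t^+}=1$, where $\iota\in\mathbb{R}^N$ is the vector of ones. Define $$\Sigma^*:=\frac{\beta}{\gamma}I+\Sigma,\qquad \mu^*:=\mu+\beta\,\omega_{t^+}.$$ Then the mean-variance problem with quadratic transaction costs is equivalent to a mean-variance problem without transaction costs with parameters $\mu^*$ and $\Sigma^*$: $$\operatorname*{arg\,max}_{\omega\in\mathbb{R}^N,\ \iota'\omega=1}\ \Big\{\omega'\mu-\frac{\beta}{2}(\omega-\omega_{t^+})'(\omega-\omega_{t^+})-\frac{\gamma}{2}\omega'\Sigma\omega\Big\}=\operatorname*{arg\,min}_{\omega\in\mathbb{R}^N,\ \iota'\omega=1}\ \Big\{\frac{\gamma}{2}\omega'\Sigma^*\omega-\omega'\mu^*\Big\}.$$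
   Context: $I$ is the $N\times N$ identity matrix and a prime denotes transposition. $\mu,\Sigma$ are the mean and covariance of asset returns, $\gamma$ is risk aversion, $\beta$ is the transaction cost parameter, $\omega_{t^+}$ is the portfolio held before rebalancing (its weights sum to one). *)

theory Defs
  imports "HOL-Analysis.Analysis"
begin

definition pos_def_matrix :: "real^'n^'n \<Rightarrow> bool" where
  "pos_def_matrix A \<longleftrightarrow> transpose A = A \<and> (\<forall>x. x \<noteq> 0 \<longrightarrow> x \<bullet> (A *v x) > 0)"

definition ones :: "real^'n" where
  "ones = (\<chi> i. 1)"

text \<open>Short positions are allowed: weights may be negative, only the budget constraint is imposed.\<close>

definition portfolios :: "(real^'n) set" where
  "portfolios = {w. ones \<bullet> w = 1}"

text \<open>The arg max and arg min are the sets of all optimisers of the objective over the feasible set.\<close>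

definition argmax_on :: "'a set \<Rightarrow> ('a \<Rightarrow> real) \<Rightarrow> 'a set" where
  "argmax_on S f = {x. is_arg_max f (\<lambda>x. x \<in> S) x}"

definition argmin_on :: "'a set \<Rightarrow> ('a \<Rightarrow> real) \<Rightarrow> 'a set" where
  "argmin_on S f = {x. is_arg_min f (\<lambda>x. x \<in> S) x}"

definition cov_star :: "real \<Rightarrow> real \<Rightarrow> real^'n^'n \<Rightarrow> real^'n^'n" where
  "cov_star \<beta> \<gamma> \<Sigma> = (\<beta> / \<gamma>) *\<^sub>R mat 1 + \<Sigma>"

definition mean_star :: "real \<Rightarrow> real^'n \<Rightarrow> real^'n \<Rightarrow> real^'n" where
  "mean_star \<beta> \<mu> w0 = \<mu> + \<beta> *\<^sub>R w0"

end

theory Submission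
  imports Defs
begin

text \<open>Expanding the transaction cost gives a quadratic term
  \<open>\<beta> / 2 * (w \<bullet> w)\<close>, which is absorbed into the risk term as a multiple
  of the identity, a cross term \<open>\<beta> * (w \<bullet> w0)\<close>, which is absorbed into
  the mean, and a constant. Hence the two objectives, up to sign, differ by a constant at every
  \<open>w\<close>, and \<open>argmax_on_eq_argmin_on_if_diff_const\<close> applies:
  \<open>f y > f x\<close> holds exactly when \<open>g y < g x\<close>, so the same points are
  optimal.\<close>

lemma argmax_on_eq_argmin_on_if_diff_const:
  assumes "\<And>x. f x = c - g x"
  shows "argmax_on S f = argmin_on S g"
  using assms by (simp add: argmax_on_def argmin_on_def is_arg_max_def is_arg_min_def)

text \<open>The outer factor \<gamma> cancels the denominator in \<open>\<beta> / \<gamma>\<close>,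
  so the added multiple of the identity contributes precisely the quadratic part of the cost
  penalty.\<close>

lemma cov_star_quadratic_form:
  assumes "\<gamma> \<noteq> 0"
  shows "\<gamma> * (w \<bullet> (cov_star \<beta> \<gamma> \<Sigma> *v w)) = \<beta> * (w \<bullet> w) + \<gamma> * (w \<bullet> (\<Sigma> *v w))"
  using assms
  by (simp add: cov_star_def matrix_vector_mult_add_rdistrib inner_add_right
      scaleR_matrix_vector_assoc[symmetric] distrib_left)

theorem mainTheorem1:
  fixes \<Sigma> :: "real^'n^'n" and \<mu> w0 :: "real^'n" and \<beta> \<gamma> :: real
  assumes "pos_def_matrix \<Sigma>"
    and "\<gamma> > 0" and "\<beta> > 0"
    and "ones \<bullet> w0 = 1"
  shows "argmax_on portfolios
           (\<lambda>w. w \<bullet> \<mu> - \<beta> / 2 * ((w - w0) \<bullet> (w - w0)) - \<gamma> / 2 * (w \<bullet> (\<Sigma> *v w)))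
       = argmin_on portfolios
           (\<lambda>w. \<gamma> / 2 * (w \<bullet> (cov_star \<beta> \<gamma> \<Sigma> *v w)) - w \<bullet> mean_star \<beta> \<mu> w0)"
\<comment> \<open>The constant \<open>c\<close> is the part of the expanded cost penalty that does
  not depend on \<open>w\<close>.\<close>
proof (rule argmax_on_eq_argmin_on_if_diff_const[where c = "- \<beta> / 2 * (w0 \<bullet> w0)"])
  fix w :: "real^'n"
  have "(w - w0) \<bullet> (w - w0) = w \<bullet> w - 2 * (w \<bullet> w0) + w0 \<bullet> w0"
    by (simp add: inner_diff_left inner_diff_right inner_commute)
  moreover have "w \<bullet> mean_star \<beta> \<mu> w0 = w \<bullet> \<mu> + \<beta> * (w \<bullet> w0)"
    by (simp add: mean_star_def inner_add_right)
  moreover have "\<gamma> / 2 * (w \<bullet> (cov_star \<beta> \<gamma> \<Sigma> *v w)) = \<beta> / 2 * (w \<bullet> w) + \<gamma> / 2 * (w \<bullet> (\<Sigma> *v w))"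
    using cov_star_quadratic_form[of \<gamma> w \<beta> \<Sigma>] \<open>\<gamma> > 0\<close> by simp
  ultimately show "w \<bullet> \<mu> - \<beta> / 2 * ((w - w0) \<bullet> (w - w0)) - \<gamma> / 2 * (w \<bullet> (\<Sigma> *v w))
      = - \<beta> / 2 * (w0 \<bullet> w0)
        - (\<gamma> / 2 * (w \<bullet> (cov_star \<beta> \<gamma> \<Sigma> *v w)) - w \<bullet> mean_star \<beta> \<mu> w0)"
    by (simp add: algebra_simps)
qed

end
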